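(* Let $\mathcal M$ be a maximal space-like surface in $\mathbb R^4_2$ and let the complex parameter $t=u+\mathrm i v$ give canonical coordinates in a neighborhood of a point $p\in\mathcal M$. Suppose that the function $\Phi=x_u-\mathrm i x_v=(\phi_1,\phi_2,\phi_3,\phi_4)$ satisfies $\phi_1+\mathrm i\phi_2\neq 0$. Then there exists a neighborhood of $p$ in which $\Phi$ has the representation $$\Phi=\left(\frac12\,\frac{g_1g_2+1}{\sqrt{g_1'g_2'}},\ \frac{\mathrm i}{2}\,\frac{g_1g_2-1}{\sqrt{g_1'g_2'}},\ \frac12\,\frac{g_1+g_2}{\sqrt{g_1'g_2'}},\ \frac{\mathrm i}{2}\,\frac{g_1-g_2}{\sqrt{g_1'g_2'}}\right),\qquad(\ast)$$ where $g_1,g_2$ are holomorphic functions of $t$ satisfying $$g_1'g_2'\neq0,\ |g_1|>1,\ |g_2|>1\qquad\text{or}\qquad g_1'g_2'\neq0,\ |g_1|<1,\ |g_2|<1.\qquad(\ast\ast)$$ The functions $g_1,g_2$ are determined uniquely by $\Phi$ via $$g_1=\frac{\phi_3-\mathrm i\phi_4}{\phi_1+\mathrm i\phi_2},\qquad g_2=\frac{\phi_3+\mathrm i\phi_4}{\phi_1+\mathrm i\phi_2}.$$ Conversely, let $g_1,g_2$ be holomorphic functions defined in a domain $\mathcal D\subset\mathbb C$ satisfying $(\ast\ast)$, and let $p\in\mathcal D$. Then there exist a sub-domain $\mathcal D_0\subset\mathcal D$ containing $p$ and a maximal space-like surface of general type $(\mathcal D_0,x)$ in $\mathbb R^4_2$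 such that the corresponding function $\Phi$ has the representation $(\ast)$ in $\mathcal D_0$ and satisfies $\phi_1+\mathrm i\phi_2\neq0$.
   Context: $\mathbb R^4_2$ is $\mathbb R^4$ with the scalar product $a\cdot b=a_1b_1+a_2b_2-a_3b_3-a_4b_4$, extended complex-bilinearly to $\mathbb C^4$; write $a^2=a\cdot a$. A surface (locally $(\mathcal D,x)$ with $x:\mathcal D\to\mathbb R^4_2$ an immersion, $\mathcal D\subset\mathbb R^2\equiv\mathbb C$) is space-like if the induced metric is positive definite, and maximal if its mean curvature vector $H=\frac12\operatorname{trace}\sigma$ vanishes ($\sigma$ is the second fundamental form). Coordinates $(u,v)$, $t=u+\mathrm i v$, are isothermal if $x_u^2=x_v^2$ and $x_u\cdot x_v=0$. Put $\Phi(t)=x_u-\mathrm i x_v$; on a maximal space-like surface in isothermal coordinates $\Phi$ is holomorphic. Let $\Phi'^{\bot}$ be the component of $\Phi'$ in the complexified normal space. Isothermal coordinates are called canonical (of the first type) if $(\Phi'^{\bot})^2=-1$. A point is degenerate if $(\Phi'^{\bot})^2=0$ there; a maximal space-like surface is of general type if it has no degenerate points. In $(\ast)$, $\sqrt{g_1'g_2'}$ denotes a holomorphic branch of the square root. *)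

theory Defs
  imports "HOL-Analysis.Analysis"
begin

text \<open>The scalar product of signature (2,2). At type \<^typ>\<open>real\<close> this is the scalar product of the ambient
  space, at type \<^typ>\<open>complex\<close> its complex-bilinear (not Hermitian) extension.\<close>

definition sprod :: "('a::comm_ring_1)^4 \<Rightarrow> 'a^4 \<Rightarrow> 'a" (infixl "\<bullet>\<^sub>2" 70) where
  "a \<bullet>\<^sub>2 b = a $ 1 * b $ 1 + a $ 2 * b $ 2 - a $ 3 * b $ 3 - a $ 4 * b $ 4"

definition cplx :: "real^4 \<Rightarrow> complex^4" where
  "cplx a = (\<chi> i. complex_of_real (a $ i))"

definition is_domain :: "complex set \<Rightarrow> bool" where
  "is_domain D \<longleftrightarrow> open D \<and> connected D \<and> D \<noteq> {}"

text \<open>The parameter plane is \<^typ>\<open>complex\<close> with t = u + iv, so the coordinate directions are 1 and i.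
  \<open>frechet_derivative\<close> is the real derivative.\<close>

definition du :: "(complex \<Rightarrow> 'b::real_normed_vector) \<Rightarrow> complex \<Rightarrow> 'b" where
  "du f t = frechet_derivative f (at t) 1"

definition dv :: "(complex \<Rightarrow> 'b::real_normed_vector) \<Rightarrow> complex \<Rightarrow> 'b" where
  "dv f t = frechet_derivative f (at t) \<i>"

primrec C_diff :: "nat \<Rightarrow> complex set \<Rightarrow> (complex \<Rightarrow> 'b::real_normed_vector) \<Rightarrow> bool" where
  "C_diff 0 D f \<longleftrightarrow> continuous_on D f"
| "C_diff (Suc k) D f \<longleftrightarrow>
     (\<forall>t\<in>D. f differentiable (at t)) \<and> C_diff k D (du f) \<and> C_diff k D (dv f)"

definition smooth :: "complex set \<Rightarrow> (complex \<Rightarrow> 'b::real_normed_vector) \<Rightarrow> bool" where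
  "smooth D f \<longleftrightarrow> (\<forall>k. C_diff k D f)"

definition immersed_surface :: "complex set \<Rightarrow> (complex \<Rightarrow> real^4) \<Rightarrow> bool" where
  "immersed_surface D x \<longleftrightarrow>
     is_domain D \<and> smooth D x \<and> (\<forall>t\<in>D. inj (frechet_derivative x (at t)))"

definition spacelike :: "complex set \<Rightarrow> (complex \<Rightarrow> real^4) \<Rightarrow> bool" where
  "spacelike D x \<longleftrightarrow>
     (\<forall>t\<in>D. \<forall>w. w \<noteq> 0 \<longrightarrow>
        0 < frechet_derivative x (at t) w \<bullet>\<^sub>2 frechet_derivative x (at t) w)"

text \<open>The component of \<open>w\<close> orthogonal to the plane spanned by \<open>X\<close> and \<open>Y\<close>. It is well defined if the
  scalar product is nondegenerate on this plane, as it is on the (complexified) tangent planes of a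
  space-like surface.\<close>

definition normal_part :: "('a::field)^4 \<Rightarrow> 'a^4 \<Rightarrow> 'a^4 \<Rightarrow> 'a^4" where
  "normal_part X Y w =
     (THE n. n \<bullet>\<^sub>2 X = 0 \<and> n \<bullet>\<^sub>2 Y = 0 \<and> (\<exists>a b. w = a *s X + b *s Y + n))"

text \<open>\<^term>\<open>mean_curv x t\<close> is half the trace of the second fundamental form \<open>\<sigma>\<close> with respect to the
  induced metric \<open>E du\<^sup>2 + 2F du dv + G dv\<^sup>2\<close>, in arbitrary coordinates; the values of \<open>\<sigma>\<close> on the
  coordinate fields are the normal parts of the second partial derivatives of \<open>x\<close>.\<close>

definition mean_curv :: "(complex \<Rightarrow> real^4) \<Rightarrow> complex \<Rightarrow> real^4" where
  "mean_curv x t =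
    (let X = du x t; Y = dv x t;
         E = X \<bullet>\<^sub>2 X; F = X \<bullet>\<^sub>2 Y; G = Y \<bullet>\<^sub>2 Y;
         \<sigma>\<^sub>u\<^sub>u = normal_part X Y (du (du x) t);
         \<sigma>\<^sub>u\<^sub>v = normal_part X Y (du (dv x) t);
         \<sigma>\<^sub>v\<^sub>v = normal_part X Y (dv (dv x) t)
     in (1/2) *s ((1 / (E * G - F\<^sup>2)) *s (G *s \<sigma>\<^sub>u\<^sub>u - (2 * F) *s \<sigma>\<^sub>u\<^sub>v + E *s \<sigma>\<^sub>v\<^sub>v)))"

definition maximal_spacelike_surface :: "complex set \<Rightarrow> (complex \<Rightarrow> real^4) \<Rightarrow> bool" where
  "maximal_spacelike_surface D x \<longleftrightarrow>
     immersed_surface D x \<and> spacelike D x \<and> (\<forall>t\<in>D. mean_curv x t = 0)"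

definition isothermal :: "complex set \<Rightarrow> (complex \<Rightarrow> real^4) \<Rightarrow> bool" where
  "isothermal D x \<longleftrightarrow>
     (\<forall>t\<in>D. du x t \<bullet>\<^sub>2 du x t = dv x t \<bullet>\<^sub>2 dv x t \<and> du x t \<bullet>\<^sub>2 dv x t = 0)"

definition Phi :: "(complex \<Rightarrow> real^4) \<Rightarrow> complex \<Rightarrow> complex^4" where
  "Phi x t = cplx (du x t) - \<i> *s cplx (dv x t)"

definition Phi_deriv :: "(complex \<Rightarrow> real^4) \<Rightarrow> complex \<Rightarrow> complex^4" where
  "Phi_deriv x t = (\<chi> i. deriv (\<lambda>z. Phi x z $ i) t)"

definition Phi_deriv_normal :: "(complex \<Rightarrow> real^4) \<Rightarrow> complex \<Rightarrow> complex^4" where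
  "Phi_deriv_normal x t = normal_part (cplx (du x t)) (cplx (dv x t)) (Phi_deriv x t)"

text \<open>Canonical coordinates of the first type.\<close>

definition canonical :: "complex set \<Rightarrow> (complex \<Rightarrow> real^4) \<Rightarrow> bool" where
  "canonical D x \<longleftrightarrow> isothermal D x \<and>
     (\<forall>t\<in>D. Phi_deriv_normal x t \<bullet>\<^sub>2 Phi_deriv_normal x t = -1)"

text \<open>The next two notions are meaningful only in isothermal coordinates.\<close>

definition degenerate_point :: "(complex \<Rightarrow> real^4) \<Rightarrow> complex \<Rightarrow> bool" where
  "degenerate_point x t \<longleftrightarrow> Phi_deriv_normal x t \<bullet>\<^sub>2 Phi_deriv_normal x t = 0"

definition general_type :: "complex set \<Rightarrow> (complex \<Rightarrow> real^4) \<Rightarrow> bool" where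
  "general_type D x \<longleftrightarrow> (\<forall>t\<in>D. \<not> degenerate_point x t)"

definition admissible_pair :: "complex set \<Rightarrow> (complex \<Rightarrow> complex) \<Rightarrow> (complex \<Rightarrow> complex) \<Rightarrow> bool" where
  "admissible_pair D g1 g2 \<longleftrightarrow>
     g1 holomorphic_on D \<and> g2 holomorphic_on D \<and>
     ((\<forall>t\<in>D. deriv g1 t * deriv g2 t \<noteq> 0 \<and> norm (g1 t) > 1 \<and> norm (g2 t) > 1) \<or>
      (\<forall>t\<in>D. deriv g1 t * deriv g2 t \<noteq> 0 \<and> norm (g1 t) < 1 \<and> norm (g2 t) < 1))"

text \<open>Here \<open>s\<close> is the holomorphic branch of the square root of \<open>g1' g2'\<close>.\<close>

definition weierstrass_rep ::
    "complex set \<Rightarrow> (complex \<Rightarrow> complex^4) \<Rightarrow> (complex \<Rightarrow> complex) \<Rightarrow> (complex \<Rightarrow> complex) \<Rightarrow> bool" where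
  "weierstrass_rep D \<Phi> g1 g2 \<longleftrightarrow>
     (\<exists>s. s holomorphic_on D \<and>
       (\<forall>t\<in>D. (s t)\<^sup>2 = deriv g1 t * deriv g2 t \<and>
          \<Phi> t $ 1 = 1/2 * ((g1 t * g2 t + 1) / s t) \<and>
          \<Phi> t $ 2 = \<i>/2 * ((g1 t * g2 t - 1) / s t) \<and>
          \<Phi> t $ 3 = 1/2 * ((g1 t + g2 t) / s t) \<and>
          \<Phi> t $ 4 = \<i>/2 * ((g1 t - g2 t) / s t)))"

end

theory Submission
  imports Defs "HOL-Complex_Analysis.Cauchy_Integral_Formula"
begin

text \<open>In isothermal coordinates vanishing of the mean curvature means that the normal part of
  \<open>x\<^sub>u\<^sub>u + x\<^sub>v\<^sub>v\<close> vanishes; its tangential part always does, so \<open>x\<close> is harmonic and \<open>\<Phi>\<close> is holomorphic.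
  A null vector \<open>\<Phi>\<close> with \<open>a = \<phi>\<^sub>1 + \<i>\<phi>\<^sub>2 \<noteq> 0\<close> is determined by \<open>a\<close>, \<open>g\<^sub>1\<close>, \<open>g\<^sub>2\<close>, and then
  \<open>\<bar>\<phi>\<^sub>1\<bar>\<^sup>2 + \<bar>\<phi>\<^sub>2\<bar>\<^sup>2 - \<bar>\<phi>\<^sub>3\<bar>\<^sup>2 - \<bar>\<phi>\<^sub>4\<bar>\<^sup>2 = \<bar>a\<bar>\<^sup>2 (1 - \<bar>g\<^sub>1\<bar>\<^sup>2) (1 - \<bar>g\<^sub>2\<bar>\<^sup>2) / 2\<close>, so the surface is space-like exactly
  when \<open>\<bar>g\<^sub>1\<bar>\<close> and \<open>\<bar>g\<^sub>2\<bar>\<close> lie on the same side of 1. Differentiating \<open>\<Phi>\<^sup>2 = 0\<close> shows that the tangential part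
  of \<open>\<Phi>'\<close> is a multiple of \<open>\<Phi>\<close>, so its normal part has the square \<open>\<Phi>'\<^sup>2 = -a\<^sup>2 g\<^sub>1' g\<^sub>2'\<close>; canonical coordinates are
  therefore those with \<open>a\<^sup>2 g\<^sub>1' g\<^sub>2' = 1\<close>. Conversely, \<open>x\<close> is the real part of a primitive of \<open>\<Phi>\<close> on a disc.\<close>

section \<open>Symmetry of second derivatives\<close>

text \<open>The mean value theorem is applied twice: along \<open>a\<close> to the difference of
  \<open>f\<close> across the step \<open>h\<close> in direction \<open>b\<close>, then along
  \<open>b\<close> to the derivative of \<open>f\<close> in direction \<open>a\<close>. The second
  difference is symmetric in \<open>a\<close> and \<open>b\<close>, so the same quantity also
  computes the other mixed derivative.\<close>

lemma second_difference_mvt: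
  fixes f :: "'a::real_normed_vector \<Rightarrow> real"
  assumes f: "\<And>q. q \<in> ball p e \<Longrightarrow> (f has_derivative f' q) (at q)"
    and fa: "\<And>q. q \<in> ball p e \<Longrightarrow> ((\<lambda>z. f' z a) has_derivative f'' q) (at q)"
    and h: "0 < h" "h * (norm a + norm b) < e"
  obtains q where "dist p q \<le> h * (norm a + norm b)"
    and "f (p + h *\<^sub>R a + h *\<^sub>R b) - f (p + h *\<^sub>R a) - f (p + h *\<^sub>R b) + f p = h * h * f'' q b"
proof -
  have dist: "dist p (p + s *\<^sub>R a + r *\<^sub>R b) \<le> h * (norm a + norm b)"
    if "0 \<le> s" "s \<le> h" "0 \<le> r" "r \<le> h" for s r
  proof -
    have "dist p (p + s *\<^sub>R a + r *\<^sub>R b) = norm (s *\<^sub>R a + r *\<^sub>R b)"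
      by (simp add: dist_norm norm_minus_commute add.commute)
    also have "\<dots> \<le> s * norm a + r * norm b"
      using norm_triangle_ineq[of "s *\<^sub>R a" "r *\<^sub>R b"] that by simp
    also have "\<dots> \<le> h * norm a + h * norm b"
      using that by (intro add_mono mult_right_mono) auto
    finally show ?thesis by (simp add: algebra_simps)
  qed
  have ball: "p + s *\<^sub>R a + r *\<^sub>R b \<in> ball p e"
    if "0 \<le> s" "s \<le> h" "0 \<le> r" "r \<le> h" for s r
    using dist[OF that] h by simp
  \<comment> \<open>The summand \<open>0 *\<^sub>R b\<close> is kept so that both terms are cases,
    \<open>r = h\<close> and \<open>r = 0\<close>, of one derivative formula.\<close>
  have "\<exists>s\<in>{0<..<h}.
      (f (p + h *\<^sub>R a + h *\<^sub>R b) - f (p + h *\<^sub>R a + 0 *\<^sub>R b)) -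
      (f (p + 0 *\<^sub>R a + h *\<^sub>R b) - f (p + 0 *\<^sub>R a + 0 *\<^sub>R b)) =
      (\<lambda>k. f' (p + s *\<^sub>R a + h *\<^sub>R b) (k *\<^sub>R a) - f' (p + s *\<^sub>R a + 0 *\<^sub>R b) (k *\<^sub>R a)) (h - 0)"
    (is "\<exists>s\<in>_. _ = ?D s (h - 0)")
  proof (rule mvt_simple[OF h(1)])
    fix s assume s: "0 \<le> s" "s \<le> h"
    have *: "((\<lambda>s. f (p + s *\<^sub>R a + r *\<^sub>R b)) has_derivative
        (\<lambda>k. f' (p + s *\<^sub>R a + r *\<^sub>R b) (k *\<^sub>R a))) (at s within {0..h})"
      if "0 \<le> r" "r \<le> h" for r
      by (rule has_derivative_compose[of "\<lambda>s. p + s *\<^sub>R a + r *\<^sub>R b" "\<lambda>k. k *\<^sub>R a" s _ f, OF _ f[OF ball[OF s that]]])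
        (auto intro!: derivative_eq_intros)
    show "((\<lambda>s. f (p + s *\<^sub>R a + h *\<^sub>R b) - f (p + s *\<^sub>R a + 0 *\<^sub>R b)) has_derivative ?D s) (at s within {0..h})"
      using h by (intro has_derivative_diff *) auto
  qed
  then obtain s where s: "0 < s" "s < h"
    and eq1: "f (p + h *\<^sub>R a + h *\<^sub>R b) - f (p + h *\<^sub>R a) - f (p + h *\<^sub>R b) + f p =
      f' (p + s *\<^sub>R a + h *\<^sub>R b) (h *\<^sub>R a) - f' (p + s *\<^sub>R a + 0 *\<^sub>R b) (h *\<^sub>R a)"
    by auto
  have "\<exists>r\<in>{0<..<h}. f' (p + s *\<^sub>R a + h *\<^sub>R b) a - f' (p + s *\<^sub>R a + 0 *\<^sub>R b) a =
      (\<lambda>k. f'' (p + s *\<^sub>R a + r *\<^sub>R b) (k *\<^sub>R b)) (h - 0)"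
  proof (rule mvt_simple[OF h(1)])
    fix r assume r: "0 \<le> r" "r \<le> h"
    show "((\<lambda>r. f' (p + s *\<^sub>R a + r *\<^sub>R b) a) has_derivative
        (\<lambda>k. f'' (p + s *\<^sub>R a + r *\<^sub>R b) (k *\<^sub>R b))) (at r within {0..h})"
      by (rule has_derivative_compose[of "\<lambda>r. p + s *\<^sub>R a + r *\<^sub>R b" "\<lambda>k. k *\<^sub>R b" r _ "\<lambda>z. f' z a",
            OF _ fa[OF ball[OF _ _ r]]])
        (use s in \<open>auto intro!: derivative_eq_intros\<close>)
  qed
  then obtain r where r: "0 < r" "r < h"
    and eq2: "f' (p + s *\<^sub>R a + h *\<^sub>R b) a - f' (p + s *\<^sub>R a + 0 *\<^sub>R b) a =
      f'' (p + s *\<^sub>R a + r *\<^sub>R b) (h *\<^sub>R b)"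
    by auto
  have scale: "f' q (h *\<^sub>R a) = h * f' q a" "f'' q (h *\<^sub>R b) = h * f'' q b" if "q \<in> ball p e" for q
    using f[OF that] fa[OF that]
    by (simp_all add: has_derivative_linear linear_cmul)
  have inball: "p + s *\<^sub>R a + h *\<^sub>R b \<in> ball p e" "p + s *\<^sub>R a + 0 *\<^sub>R b \<in> ball p e"
      "p + s *\<^sub>R a + r *\<^sub>R b \<in> ball p e"
    using s r h(1) by (intro ball; simp)+
  have "f (p + h *\<^sub>R a + h *\<^sub>R b) - f (p + h *\<^sub>R a) - f (p + h *\<^sub>R b) + f p
      = h * (f' (p + s *\<^sub>R a + h *\<^sub>R b) a - f' (p + s *\<^sub>R a + 0 *\<^sub>R b) a)"
    unfolding eq1 scale(1)[OF inball(1)] scale(1)[OF inball(2)] by (simp only: right_diff_distrib)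
  also have "\<dots> = h * h * f'' (p + s *\<^sub>R a + r *\<^sub>R b) b"
    unfolding eq2 scale(2)[OF inball(3)] by simp
  finally show thesis
    using s r by (intro that[of "p + s *\<^sub>R a + r *\<^sub>R b"] dist) auto
qed

text \<open>Clairaut's theorem: on small parallelograms one and the same second difference is
  \<open>h * h\<close> times either mixed derivative, each at some point close to \<open>p\<close>.
  As the parallelograms shrink, continuity moves both points to \<open>p\<close>.\<close>

lemma second_derivative_symmetric:
  fixes f :: "'a::real_normed_vector \<Rightarrow> real"
  assumes "open D" "p \<in> D"
    and f: "\<And>q. q \<in> D \<Longrightarrow> (f has_derivative f' q) (at q)"
    and fa: "\<And>q. q \<in> D \<Longrightarrow> ((\<lambda>z. f' z a) has_derivative fa' q) (at q)"
    and fb: "\<And>q. q \<in> D \<Longrightarrow> ((\<lambda>z. f' z b) has_derivative fb' q) (at q)"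
    and cont: "continuous_on D (\<lambda>q. fa' q b)" "continuous_on D (\<lambda>q. fb' q a)"
  shows "fa' p b = fb' p a"
proof -
  obtain e where e: "0 < e" "ball p e \<subseteq> D"
    using assms(1,2) by (meson open_contains_ball)
  \<comment> \<open>Dividing by \<open>norm a + norm b + 1\<close> keeps the parallelogram inside
    the ball of radius \<open>e\<close>; the 1 excludes a zero denominator when both directions
    vanish. The factor \<open>1 / Suc n\<close> makes the sequence tend to 0.\<close>
  define h where "h n = e / 2 / (norm a + norm b + 1) / real (Suc n)" for n :: nat
  define r where "r n = h n * (norm a + norm b)" for n
  have pos: "norm a + norm b + 1 > 0" by (smt (verit) norm_ge_zero)
  have hpos: "h n > 0" for n
    unfolding h_def using e pos by simp
  have "h \<longlonglongrightarrow> 0"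
    unfolding h_def by (rule LIMSEQ_Suc[OF lim_const_over_n])
  then have r0: "r \<longlonglongrightarrow> 0"
    unfolding r_def using tendsto_mult_right_zero[of h sequentially "norm a + norm b"]
    by (simp add: mult.commute)
  have rlt: "r n < e" for n
  proof -
    have "h n \<le> e / 2 / (norm a + norm b + 1)"
      unfolding h_def using e pos by (simp add: divide_le_eq mult_le_cancel_left1)
    then have "r n \<le> e / 2 / (norm a + norm b + 1) * (norm a + norm b)"
      unfolding r_def by (intro mult_right_mono) auto
    also have "\<dots> < e" using e pos by (simp add: field_simps add_nonneg_pos)
    finally show ?thesis .
  qed
  have "\<exists>q q'. dist p q \<le> r n \<and> dist p q' \<le> r n \<and> fa' q b = fb' q' a" for n
  proof -
    obtain q where q: "dist p q \<le> h n * (norm a + norm b)"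
      "f (p + h n *\<^sub>R a + h n *\<^sub>R b) - f (p + h n *\<^sub>R a) - f (p + h n *\<^sub>R b) + f p = h n * h n * fa' q b"
      by (rule second_difference_mvt[of p e f f' a fa' "h n" b])
        (use f fa e hpos rlt[of n] in \<open>auto simp: r_def\<close>)
    obtain q' where q': "dist p q' \<le> h n * (norm b + norm a)"
      "f (p + h n *\<^sub>R b + h n *\<^sub>R a) - f (p + h n *\<^sub>R b) - f (p + h n *\<^sub>R a) + f p = h n * h n * fb' q' a"
      by (rule second_difference_mvt[of p e f f' b fb' "h n" a])
        (use f fb e hpos rlt[of n] in \<open>auto simp: r_def add.commute\<close>)
    have "h n * h n * fa' q b = h n * h n * fb' q' a"
      using q(2) q'(2) by (simp add: algebra_simps)
    then show ?thesis
      using q(1) q'(1) hpos[of n] by (auto simp: r_def add.commute)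
  qed
  then obtain q q' where q: "\<And>n. dist p (q n) \<le> r n" "\<And>n. dist p (q' n) \<le> r n"
    and eq: "\<And>n. fa' (q n) b = fb' (q' n) a"
    by metis
  have lim: "u \<longlonglongrightarrow> p" if "\<And>n. dist p (u n) \<le> r n" for u
  proof -
    have "(\<lambda>n. dist (u n) p) \<longlonglongrightarrow> 0"
      by (rule tendsto_sandwich[OF _ _ tendsto_const r0]) (use that in \<open>auto simp: dist_commute\<close>)
    then show ?thesis by (rule tendsto_dist_iff[THEN iffD2])
  qed
  have inD: "u n \<in> D" if "\<And>n. dist p (u n) \<le> r n" for u n
    using le_less_trans[OF that rlt, of n] e by auto
  have "(\<lambda>n. fa' (q n) b) \<longlonglongrightarrow> fa' p b" "(\<lambda>n. fb' (q' n) a) \<longlonglongrightarrow> fb' p a"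
    using continuous_on_tendsto_compose[OF cont(1) lim[OF q(1)] assms(2) always_eventually]
      continuous_on_tendsto_compose[OF cont(2) lim[OF q(2)] assms(2) always_eventually]
      inD[OF q(1)] inD[OF q(2)] by simp_all
  then show ?thesis
    unfolding eq by (rule LIMSEQ_unique)
qed

text \<open>\<open>C_diff\<close> iterates the partial derivatives without identifying the mixed
  ones, so their equality is obtained here, component by component, from the directions 1 and
  \<open>\<i>\<close>.\<close>

lemma mixed_partials:
  fixes f :: "complex \<Rightarrow> real^'n"
  assumes "open D" "p \<in> D" and C2: "C_diff (Suc (Suc 0)) D f"
  shows "dv (du f) p = du (dv f) p"
proof -
  have "dv (du f) p $ i = du (dv f) p $ i" for i
  proof -
    have nth: "((\<lambda>z. g z $ i) has_derivative (\<lambda>w. frechet_derivative g (at q) w $ i)) (at q)"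
      if "g differentiable (at q)" for g :: "complex \<Rightarrow> real^'n" and q
      using that by (intro bounded_linear.has_derivative[OF bounded_linear_vec_nth])
        (simp add: frechet_derivative_works)
    have cont: "continuous_on D (\<lambda>q. dv (du f) q $ i)" "continuous_on D (\<lambda>q. du (dv f) q $ i)"
      using C2 by (auto intro!: continuous_intros)
    show ?thesis
      using second_derivative_symmetric[of D p "\<lambda>z. f z $ i" "\<lambda>q w. frechet_derivative f (at q) w $ i" 1
          "\<lambda>q w. frechet_derivative (du f) (at q) w $ i" \<i>
          "\<lambda>q w. frechet_derivative (dv f) (at q) w $ i"]
        assms(1,2) C2 cont nth[of f] nth[of "du f"] nth[of "dv f"]
      by (simp add: du_def[abs_def] dv_def[abs_def])
  qed
  then show ?thesis by (simp add: vec_eq_iff)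
qed

section \<open>Algebra of the scalar product\<close>

lemma sprod_simps:
  "(a + b) \<bullet>\<^sub>2 c = a \<bullet>\<^sub>2 c + b \<bullet>\<^sub>2 c" "c \<bullet>\<^sub>2 (a + b) = c \<bullet>\<^sub>2 a + c \<bullet>\<^sub>2 b"
  "(a - b) \<bullet>\<^sub>2 c = a \<bullet>\<^sub>2 c - b \<bullet>\<^sub>2 c" "c \<bullet>\<^sub>2 (a - b) = c \<bullet>\<^sub>2 a - c \<bullet>\<^sub>2 b"
  "(k *s a) \<bullet>\<^sub>2 c = k * (a \<bullet>\<^sub>2 c)" "c \<bullet>\<^sub>2 (k *s a) = k * (c \<bullet>\<^sub>2 a)"
  "(- a) \<bullet>\<^sub>2 c = - (a \<bullet>\<^sub>2 c)" "c \<bullet>\<^sub>2 (- a) = - (c \<bullet>\<^sub>2 a)"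
  by (simp_all add: sprod_def algebra_simps)

lemma sprod_commute: "a \<bullet>\<^sub>2 b = b \<bullet>\<^sub>2 a"
  by (simp add: sprod_def algebra_simps)

lemma sprod_scaleR: "(k *\<^sub>R a) \<bullet>\<^sub>2 c = k * (a \<bullet>\<^sub>2 c)" "c \<bullet>\<^sub>2 (k *\<^sub>R a) = k * (c \<bullet>\<^sub>2 a)"
  for a c :: "real^4"
  by (simp_all add: sprod_def algebra_simps)

lemma sprod_cplx: "cplx a \<bullet>\<^sub>2 cplx b = of_real (a \<bullet>\<^sub>2 b)"
  by (simp add: sprod_def cplx_def)

lemma has_derivative_sprod:
  fixes u w :: "'a::real_normed_vector \<Rightarrow> real^4"
  assumes "(u has_derivative u') (at z)" "(w has_derivative w') (at z)"
  shows "((\<lambda>z. u z \<bullet>\<^sub>2 w z) has_derivative (\<lambda>h. u z \<bullet>\<^sub>2 w' h + u' h \<bullet>\<^sub>2 w z)) (at z)"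
proof -
  have "((\<lambda>z. u z $ i) has_derivative (\<lambda>h. u' h $ i)) (at z)"
    "((\<lambda>z. w z $ i) has_derivative (\<lambda>h. w' h $ i)) (at z)" for i
    using assms by (auto intro: bounded_linear.has_derivative[OF bounded_linear_vec_nth])
  note [derivative_intros] = this
  show ?thesis
    unfolding sprod_def by (auto intro!: derivative_eq_intros simp: algebra_simps)
qed

text \<open>For an orthogonal basis of equal nonzero squares the tangential coefficients are forced
  by pairing with \<open>X\<close> and \<open>Y\<close>, which gives existence and uniqueness. The
  field is arbitrary because both the real tangent plane (mean curvature) and its complexification
  (\<open>Phi_deriv_normal\<close>) are needed.\<close>

lemma normal_part_isothermal:
  fixes X Y w :: "'a::field^4"
  assumes E: "X \<bullet>\<^sub>2 X = E" "Y \<bullet>\<^sub>2 Y = E" "X \<bullet>\<^sub>2 Y = 0" "E \<noteq> 0"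
  shows "normal_part X Y w = w - (w \<bullet>\<^sub>2 X / E) *s X - (w \<bullet>\<^sub>2 Y / E) *s Y"
  unfolding normal_part_def
proof (rule the_equality, intro conjI exI)
  have "Y \<bullet>\<^sub>2 X = 0" using E(3) by (simp add: sprod_commute)
  note E = E this
  let ?n = "w - (w \<bullet>\<^sub>2 X / E) *s X - (w \<bullet>\<^sub>2 Y / E) *s Y"
  show "?n \<bullet>\<^sub>2 X = 0" "?n \<bullet>\<^sub>2 Y = 0"
    using E by (simp_all add: sprod_simps)
  show "w = (w \<bullet>\<^sub>2 X / E) *s X + (w \<bullet>\<^sub>2 Y / E) *s Y + ?n" by simp
  fix n assume n: "n \<bullet>\<^sub>2 X = 0 \<and> n \<bullet>\<^sub>2 Y = 0 \<and> (\<exists>a b. w = a *s X + b *s Y + n)"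
  then obtain a b where w: "w = a *s X + b *s Y + n" by blast
  have "w \<bullet>\<^sub>2 X = a * E" "w \<bullet>\<^sub>2 Y = b * E"
    unfolding w using E n by (simp_all add: sprod_simps)
  then show "n = ?n" using E(4) by (simp add: w)
qed

text \<open>The tangential part of such a \<open>w\<close> is a multiple of
  \<open>X - \<i> *s Y\<close>. This vector is isotropic and orthogonal to \<open>w\<close>, so
  removing it leaves the square unchanged.\<close>

lemma sprod_normal_part_isothermal:
  fixes X Y w :: "complex^4"
  assumes E: "X \<bullet>\<^sub>2 X = E" "Y \<bullet>\<^sub>2 Y = E" "X \<bullet>\<^sub>2 Y = 0" "E \<noteq> 0"
    and "w \<bullet>\<^sub>2 (X - \<i> *s Y) = 0"
  shows "normal_part X Y w \<bullet>\<^sub>2 normal_part X Y w = w \<bullet>\<^sub>2 w"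
proof -
  have "w \<bullet>\<^sub>2 X = \<i> * (w \<bullet>\<^sub>2 Y)" using assms(5) by (simp add: sprod_simps)
  moreover have "Y \<bullet>\<^sub>2 X = 0" "X \<bullet>\<^sub>2 w = w \<bullet>\<^sub>2 X" "Y \<bullet>\<^sub>2 w = w \<bullet>\<^sub>2 Y"
    using E(3) by (simp_all add: sprod_commute)
  ultimately show ?thesis
    using E(4) by (simp add: normal_part_isothermal[OF E] sprod_simps E field_simps)
qed

section \<open>The vectors of the representation\<close>

text \<open>The parameter \<open>a\<close> stands for \<open>1 / \<surd>(g\<^sub>1' g\<^sub>2')\<close>.\<close>

definition weier :: "complex \<Rightarrow> complex \<Rightarrow> complex \<Rightarrow> complex^4" where
  "weier a g h = vector [a/2 * (g * h + 1), \<i> * a/2 * (g * h - 1), a/2 * (g + h), \<i> * a/2 * (g - h)]"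

lemma weier_nth:
  "weier a g h $ 1 = a/2 * (g * h + 1)" "weier a g h $ 2 = \<i> * a/2 * (g * h - 1)"
  "weier a g h $ 3 = a/2 * (g + h)" "weier a g h $ 4 = \<i> * a/2 * (g - h)"
  by (simp_all add: weier_def vector_def)

lemma weierstrass_rep_iff:
  "weierstrass_rep D \<Phi> g1 g2 \<longleftrightarrow>
    (\<exists>s. s holomorphic_on D \<and>
      (\<forall>t\<in>D. (s t)\<^sup>2 = deriv g1 t * deriv g2 t \<and> \<Phi> t = weier (1 / s t) (g1 t) (g2 t)))"
  unfolding weierstrass_rep_def vec_eq_iff forall_4 weier_nth
  by (simp add: mult.assoc mult.commute[of 2])

lemma weier_null: "weier a g h \<bullet>\<^sub>2 weier a g h = 0"
  by (simp add: sprod_def weier_nth field_simps)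

text \<open>These linear forms are null coordinates for the scalar product; their quotients recover
  \<open>g\<close> and \<open>h\<close> independently of \<open>a\<close>, which yields the formulas
  for the two functions.\<close>

lemma weier_coordinates:
  "weier a g h $ 1 + \<i> * weier a g h $ 2 = a"
  "weier a g h $ 3 - \<i> * weier a g h $ 4 = a * g"
  "weier a g h $ 3 + \<i> * weier a g h $ 4 = a * h"
  by (simp_all add: weier_nth field_simps)

text \<open>In null coordinates the condition reads (w3 - i w4)(w3 + i w4) = (w1 + i w2)(w1 - i w2),
  so the remaining coordinate w1 - i w2 must be a g h.\<close>

lemma weier_of_null:
  assumes "w \<bullet>\<^sub>2 w = 0" and a: "a = w $ 1 + \<i> * w $ 2" "a \<noteq> 0"
  shows "w = weier a ((w $ 3 - \<i> * w $ 4) / a) ((w $ 3 + \<i> * w $ 4) / a)"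
proof -
  have "(w $ 3 - \<i> * w $ 4) * (w $ 3 + \<i> * w $ 4) = a * (w $ 1 - \<i> * w $ 2)"
    using assms(1) by (simp add: sprod_def a(1) algebra_simps)
  then have gh: "(w $ 3 - \<i> * w $ 4) / a * ((w $ 3 + \<i> * w $ 4) / a) = (w $ 1 - \<i> * w $ 2) / a"
    using a(2) by simp
  show ?thesis
    unfolding vec_eq_iff forall_4 weier_nth gh using a(2)
    by (simp add: field_simps) (simp add: a(1) field_simps)
qed

text \<open>By the parallelogram law each pair of components contributes a sum of two squared
  moduli, and 1 + |gh|^2 - |g|^2 - |h|^2 factors.\<close>

lemma weier_norm:
  "(cmod (weier a g h $ 1))\<^sup>2 + (cmod (weier a g h $ 2))\<^sup>2 - (cmod (weier a g h $ 3))\<^sup>2 - (cmod (weier a g h $ 4))\<^sup>2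
    = (cmod a)\<^sup>2 / 2 * ((1 - (cmod g)\<^sup>2) * (1 - (cmod h)\<^sup>2))"
proof -
  have par: "(cmod (p + q))\<^sup>2 + (cmod (p - q))\<^sup>2 = 2 * (cmod p)\<^sup>2 + 2 * (cmod q)\<^sup>2" for p q
    unfolding cmod_power2 by (simp add: power2_eq_square algebra_simps)
  have "(cmod (weier a g h $ 1))\<^sup>2 + (cmod (weier a g h $ 2))\<^sup>2
      = (cmod a)\<^sup>2 / 4 * ((cmod (g * h + 1))\<^sup>2 + (cmod (g * h - 1))\<^sup>2)"
    "(cmod (weier a g h $ 3))\<^sup>2 + (cmod (weier a g h $ 4))\<^sup>2
      = (cmod a)\<^sup>2 / 4 * ((cmod (g + h))\<^sup>2 + (cmod (g - h))\<^sup>2)"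
    unfolding weier_nth norm_mult norm_divide power_mult_distrib power_divide
    by (simp_all add: algebra_simps)
  then show ?thesis
    unfolding par by (simp add: norm_mult power_mult_distrib algebra_simps)
qed

lemma one_minus_square_mult_pos_iff:
  fixes r s :: real
  assumes "0 \<le> r" "0 \<le> s"
  shows "0 < (1 - r\<^sup>2) * (1 - s\<^sup>2) \<longleftrightarrow> r > 1 \<and> s > 1 \<or> r < 1 \<and> s < 1"
proof -
  have "u\<^sup>2 < 1 \<longleftrightarrow> u < 1" "1 < u\<^sup>2 \<longleftrightarrow> 1 < u" if "0 \<le> u" for u :: real
    using that abs_square_less_1[of u] abs_square_le_1[of u] by auto
  then show ?thesis
    using assms by (auto simp: zero_less_mult_iff)
qed

text \<open>Write \<Phi> = a N with N = \<open>weier 1 g h\<close>. Since N is null, N is orthogonal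
  to N', and all terms with a' drop out. In N'^2 the first two components cancel, and the last two
  leave -g' h'.\<close>

lemma weier_deriv_square:
  assumes D: "open D" "t \<in> D" and hol: "a holomorphic_on D" "g holomorphic_on D" "h holomorphic_on D"
    and \<Phi>: "\<And>z. z \<in> D \<Longrightarrow> \<Phi> z = weier (a z) (g z) (h z)"
  defines "W \<equiv> (\<chi> i. deriv (\<lambda>z. \<Phi> z $ i) t)"
  shows "W \<bullet>\<^sub>2 W = - (a t)\<^sup>2 * (deriv g t * deriv h t)"
proof -
  have d[derivative_intros]: "(a has_field_derivative deriv a t) (at t)" "(g has_field_derivative deriv g t) (at t)"
      "(h has_field_derivative deriv h t) (at t)"
    using hol D by (auto intro: holomorphic_derivI)
  \<comment> \<open>The derivative at \<open>t\<close> sees only values near \<open>t\<close>, so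
    the formula valid on the open set may be differentiated instead of \<Phi>.\<close>
  have W: "W $ i = D'"
    if "((\<lambda>z. weier (a z) (g z) (h z) $ i) has_field_derivative D') (at t)" for i D'
  proof -
    have "((\<lambda>z. \<Phi> z $ i) has_field_derivative D') (at t)"
      by (rule has_field_derivative_transform_within_open[OF that D]) (simp add: \<Phi>)
    then show ?thesis by (simp add: W_def DERIV_imp_deriv)
  qed
  let ?gh = "deriv g t * h t + g t * deriv h t"
  have Wi: "W $ 1 = deriv a t/2 * (g t * h t + 1) + a t/2 * ?gh"
    "W $ 2 = \<i> * deriv a t/2 * (g t * h t - 1) + \<i> * a t/2 * ?gh"
    "W $ 3 = deriv a t/2 * (g t + h t) + a t/2 * (deriv g t + deriv h t)"
    "W $ 4 = \<i> * deriv a t/2 * (g t - h t) + \<i> * a t/2 * (deriv g t - deriv h t)"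
    by (rule W; unfold weier_nth; auto intro!: derivative_eq_intros simp: field_simps)+
  show ?thesis
    unfolding sprod_def Wi by (simp add: field_simps power2_eq_square)
qed


section \<open>Maximal surfaces in isothermal coordinates\<close>

lemma frechet_derivative_du_dv:
  assumes "x differentiable (at t)"
  shows "frechet_derivative x (at t) w = Re w *\<^sub>R du x t + Im w *\<^sub>R dv x t"
proof -
  interpret linear "frechet_derivative x (at t)"
    by (rule linear_frechet_derivative[OF assms])
  have "w = Re w *\<^sub>R 1 + Im w *\<^sub>R \<i>"
    by (simp add: complex_eq_iff)
  then show ?thesis
    unfolding du_def dv_def by (metis add scale)
qed

lemma du_dvI:
  assumes "(f has_derivative f') (at t)"
  shows "du f t = f' 1" "dv f t = f' \<i>"
  using frechet_derivative_at[OF assms] by (simp_all add: du_def dv_def)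

lemma maximal_spacelike_surfaceD:
  assumes "maximal_spacelike_surface D x"
  shows "open D" "C_diff k D x"
    and "t \<in> D \<Longrightarrow> x differentiable (at t)"
    and "t \<in> D \<Longrightarrow> du x t \<bullet>\<^sub>2 du x t > 0"
    and "t \<in> D \<Longrightarrow> mean_curv x t = 0"
proof -
  show "open D" and C: "C_diff k D x" for k
    using assms unfolding maximal_spacelike_surface_def immersed_surface_def is_domain_def smooth_def
    by auto
  show "t \<in> D \<Longrightarrow> x differentiable (at t)"
    using C[of "Suc 0"] by simp
  show "t \<in> D \<Longrightarrow> du x t \<bullet>\<^sub>2 du x t > 0" "t \<in> D \<Longrightarrow> mean_curv x t = 0"
    using assms unfolding maximal_spacelike_surface_def spacelike_def du_def by auto
qed

text \<open>With F = 0 and E = G the trace is the sum of the two pure second fundamental forms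
  divided by E, and the normal part is linear.\<close>

lemma mean_curv_isothermal:
  assumes "du x t \<bullet>\<^sub>2 du x t = E" "dv x t \<bullet>\<^sub>2 dv x t = E" "du x t \<bullet>\<^sub>2 dv x t = 0" "E \<noteq> 0"
  shows "mean_curv x t =
    (1 / (2 * E)) *s normal_part (du x t) (dv x t) (du (du x) t + dv (dv x) t)"
  unfolding mean_curv_def Let_def assms(1-3) normal_part_isothermal[OF assms]
  using assms(4) by (simp add: vec_eq_iff sprod_simps field_simps power2_eq_square)

text \<open>Differentiating the isothermal conditions in both directions, with the mixed partials
  equal, gives linear relations among the products of first and second derivatives; they already
  force this orthogonality.\<close>

lemma isothermal_laplacian_tangential:
  assumes "open D" "t \<in> D" and C2: "C_diff (Suc (Suc 0)) D x" and iso: "isothermal D x"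
  defines "L \<equiv> du (du x) t + dv (dv x) t"
  shows "L \<bullet>\<^sub>2 du x t = 0" "L \<bullet>\<^sub>2 dv x t = 0"
proof -
  have mixed: "dv (du x) t = du (dv x) t"
    by (rule mixed_partials[OF assms(1,2) C2])
  have D1: "(du x has_derivative frechet_derivative (du x) (at t)) (at t)"
      "(dv x has_derivative frechet_derivative (dv x) (at t)) (at t)"
    using C2 assms(2) by (simp_all flip: frechet_derivative_works)
  have const: "f' w = 0" if "(f has_derivative f') (at t)" "\<And>z. z \<in> D \<Longrightarrow> f z = 0"
    for f :: "complex \<Rightarrow> real" and f' w
  proof -
    have "((\<lambda>_. 0) has_derivative f') (at t)"
      by (rule has_derivative_transform_within_open[OF that(1) assms(1,2) that(2)])
    then have "f' = (\<lambda>_. 0)"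
      by (rule has_derivative_unique[OF _ has_derivative_const])
    then show ?thesis by simp
  qed
  let ?X = "du x t" and ?Y = "dv x t"
  have second: "frechet_derivative (du x) (at t) 1 = du (du x) t" "frechet_derivative (dv x) (at t) 1 = du (dv x) t"
      "frechet_derivative (du x) (at t) \<i> = du (dv x) t" "frechet_derivative (dv x) (at t) \<i> = dv (dv x) t"
    using mixed by (simp_all add: du_def dv_def)
  have commute: "du (du x) t \<bullet>\<^sub>2 a = a \<bullet>\<^sub>2 du (du x) t" "du (dv x) t \<bullet>\<^sub>2 a = a \<bullet>\<^sub>2 du (dv x) t"
      "dv (dv x) t \<bullet>\<^sub>2 a = a \<bullet>\<^sub>2 dv (dv x) t" for a
    by (rule sprod_commute)+
  have iso': "du x z \<bullet>\<^sub>2 du x z - dv x z \<bullet>\<^sub>2 dv x z = 0" "du x z \<bullet>\<^sub>2 dv x z = 0" if "z \<in> D" for z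
    using iso that by (auto simp: isothermal_def)
  have eq1: "(?X \<bullet>\<^sub>2 frechet_derivative (du x) (at t) w + frechet_derivative (du x) (at t) w \<bullet>\<^sub>2 ?X) -
      (?Y \<bullet>\<^sub>2 frechet_derivative (dv x) (at t) w + frechet_derivative (dv x) (at t) w \<bullet>\<^sub>2 ?Y) = 0" for w
    by (rule const[OF has_derivative_diff[OF has_derivative_sprod[OF D1(1) D1(1)]
          has_derivative_sprod[OF D1(2) D1(2)]] iso'(1)])
  have eq2: "?X \<bullet>\<^sub>2 frechet_derivative (dv x) (at t) w + frechet_derivative (du x) (at t) w \<bullet>\<^sub>2 ?Y = 0" for w
    by (rule const[OF has_derivative_sprod[OF D1(1) D1(2)] iso'(2)])
  \<comment> \<open>The first identity combines \<open>eq1\<close> at 1 with \<open>eq2\<close> at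
    \<open>\<i>\<close>, the second \<open>eq1\<close> at \<open>\<i>\<close> with
    \<open>eq2\<close> at 1.\<close>
  show "L \<bullet>\<^sub>2 ?X = 0" "L \<bullet>\<^sub>2 ?Y = 0"
    using eq1[of 1] eq1[of \<i>] eq2[of 1] eq2[of \<i>]
    unfolding L_def second commute sprod_simps by linarith+
qed

lemma maximal_isothermal_harmonic:
  assumes max: "maximal_spacelike_surface D x" and iso: "isothermal D x" and t: "t \<in> D"
  shows "du (du x) t + dv (dv x) t = 0"
proof -
  let ?E = "du x t \<bullet>\<^sub>2 du x t" and ?L = "du (du x) t + dv (dv x) t"
  note surface = maximal_spacelike_surfaceD[OF max]
  have E: "?E = ?E" "dv x t \<bullet>\<^sub>2 dv x t = ?E" "du x t \<bullet>\<^sub>2 dv x t = 0" "?E \<noteq> 0"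
    using iso t surface(4)[OF t] by (auto simp: isothermal_def)
  have "normal_part (du x t) (dv x t) ?L = ?L"
    unfolding normal_part_isothermal[OF E]
    using isothermal_laplacian_tangential[OF surface(1) t surface(2) iso] by simp
  then have "(1 / (2 * ?E)) *s ?L = 0"
    using mean_curv_isothermal[OF E] surface(5)[OF t] by simp
  then show ?thesis
    using E(4) by (simp only: vector_mul_eq_0) simp
qed

lemma Phi_holomorphic:
  assumes max: "maximal_spacelike_surface D x" and iso: "isothermal D x"
  shows "(\<lambda>z. Phi x z $ i) holomorphic_on D"
proof -
  note surface = maximal_spacelike_surfaceD[OF max]
  have "(\<lambda>z. Phi x z $ i) field_differentiable (at t)" if t: "t \<in> D" for t
  proof -
    let ?A = "du (du x) t $ i" and ?C = "du (dv x) t $ i"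
    have diff: "du x differentiable (at t)" "dv x differentiable (at t)"
      using surface(2)[of "Suc (Suc 0)"] t by auto
    have mixed: "dv (du x) t = du (dv x) t"
      by (rule mixed_partials[OF surface(1) t surface(2)])
    have "dv (dv x) t = - du (du x) t"
      using maximal_isothermal_harmonic[OF max iso t] by (simp add: eq_neg_iff_add_eq_0 add.commute)
    then have deriv_u: "((\<lambda>z. du x z $ i) has_derivative (\<lambda>w. Re w * ?A + Im w * ?C)) (at t)"
      and deriv_v: "((\<lambda>z. dv x z $ i) has_derivative (\<lambda>w. Re w * ?C - Im w * ?A)) (at t)"
      using diff[unfolded frechet_derivative_works, THEN bounded_linear.has_derivative[OF bounded_linear_vec_nth[of i]]]
        frechet_derivative_du_dv[OF diff(1)] frechet_derivative_du_dv[OF diff(2)] mixed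
      by simp_all
    have "((\<lambda>z. of_real (du x z $ i) - \<i> * of_real (dv x z $ i)) has_derivative
        (\<lambda>w. of_real (Re w * ?A + Im w * ?C) - \<i> * of_real (Re w * ?C - Im w * ?A))) (at t)"
      by (intro has_derivative_diff has_derivative_mult_right has_derivative_of_real deriv_u deriv_v)
    \<comment> \<open>Harmonicity and equal mixed partials are the Cauchy-Riemann equations: the
      real derivative is multiplication by the complex number A - iC.\<close>
    also have "(\<lambda>w. of_real (Re w * ?A + Im w * ?C) - \<i> * of_real (Re w * ?C - Im w * ?A)) =
        (*) (of_real ?A - \<i> * of_real ?C)"
      by (auto simp: fun_eq_iff complex_eq_iff algebra_simps)
    finally show ?thesis
      unfolding field_differentiable_def has_field_derivative_def Phi_def cplx_def by auto
  qed
  then show ?thesis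
    by (auto simp: holomorphic_on_def intro: field_differentiable_at_within)
qed

lemma Phi_null:
  assumes "isothermal D x" "t \<in> D"
  shows "Phi x t \<bullet>\<^sub>2 Phi x t = 0"
  using assms unfolding Phi_def isothermal_def
  by (simp add: sprod_simps sprod_cplx sprod_commute[of "dv x t" "du x t"])

text \<open>The real and imaginary parts of \<open>Phi\<close> are x_u and -x_v. This links the
  factorization in \<open>weier_norm\<close> to positivity of the induced metric.\<close>

lemma Phi_norm:
  "(cmod (Phi x t $ 1))\<^sup>2 + (cmod (Phi x t $ 2))\<^sup>2 - (cmod (Phi x t $ 3))\<^sup>2 - (cmod (Phi x t $ 4))\<^sup>2
    = du x t \<bullet>\<^sub>2 du x t + dv x t \<bullet>\<^sub>2 dv x t"
  unfolding cmod_power2 by (simp add: Phi_def cplx_def sprod_def power2_eq_square)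

text \<open>Holomorphy is a hypothesis so that the direct part can supply it from harmonicity and
  the converse from the construction.\<close>

lemma Phi_deriv_normal_square:
  assumes "open D" "t \<in> D" and iso: "isothermal D x" and E: "du x t \<bullet>\<^sub>2 du x t \<noteq> 0"
    and hol: "\<And>i. (\<lambda>z. Phi x z $ i) holomorphic_on D"
  shows "Phi_deriv_normal x t \<bullet>\<^sub>2 Phi_deriv_normal x t = Phi_deriv x t \<bullet>\<^sub>2 Phi_deriv x t"
proof -
  have d: "((\<lambda>z. Phi x z $ i) has_field_derivative Phi_deriv x t $ i) (at t)" for i
    unfolding Phi_deriv_def using holomorphic_derivI[OF hol assms(1,2)] by simp
  have "((\<lambda>z. Phi x z \<bullet>\<^sub>2 Phi x z) has_field_derivative 2 * (Phi_deriv x t \<bullet>\<^sub>2 Phi x t)) (at t)"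
    unfolding sprod_def by (auto intro!: derivative_eq_intros d)
  then have "((\<lambda>z. 0) has_field_derivative 2 * (Phi_deriv x t \<bullet>\<^sub>2 Phi x t)) (at t)"
    by (rule has_field_derivative_transform_within_open[OF _ assms(1,2)]) (rule Phi_null[OF iso])
  then have "Phi_deriv x t \<bullet>\<^sub>2 Phi x t = 0"
    using DERIV_unique[OF _ DERIV_const] by fastforce
  then show ?thesis
    unfolding Phi_deriv_normal_def using assms(2) iso E
    by (intro sprod_normal_part_isothermal[where E = "of_real (du x t \<bullet>\<^sub>2 du x t)"])
      (auto simp: sprod_cplx isothermal_def Phi_def)
qed

section \<open>Representation of canonical surfaces\<close>

lemma weierstrass_rep_local_existence:
  assumes max: "maximal_spacelike_surface D x" and can: "canonical D x" and p: "p \<in> D"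
    and ne: "Phi x p $ 1 + \<i> * Phi x p $ 2 \<noteq> 0"
  shows "\<exists>U g1 g2. open U \<and> p \<in> U \<and> U \<subseteq> D \<and> admissible_pair U g1 g2 \<and> weierstrass_rep U (Phi x) g1 g2"
proof -
  note surface = maximal_spacelike_surfaceD[OF max]
  have iso: "isothermal D x" using can by (simp add: canonical_def)
  note hol = Phi_holomorphic[OF max iso]
  define a where "a z = Phi x z $ 1 + \<i> * Phi x z $ 2" for z
  define g where "g z = (Phi x z $ 3 - \<i> * Phi x z $ 4) / a z" for z
  define h where "h z = (Phi x z $ 3 + \<i> * Phi x z $ 4) / a z" for z
  \<comment> \<open>Here the denominator of \<open>g\<close> and \<open>h\<close> has no
    zero.\<close>
  define S where "S = D \<inter> a -` (- {0})"
  have a_hol: "a holomorphic_on D"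
    unfolding a_def by (intro holomorphic_intros hol)
  have "open S"
    unfolding S_def using a_hol surface(1)
    by (intro continuous_open_preimage holomorphic_on_imp_continuous_on) auto
  have "p \<in> S" "S \<subseteq> D" using p ne by (auto simp: S_def a_def)
  have holS: "a holomorphic_on S" "g holomorphic_on S" "h holomorphic_on S"
    unfolding g_def h_def using holomorphic_on_subset[OF a_hol \<open>S \<subseteq> D\<close>]
      holomorphic_on_subset[OF hol \<open>S \<subseteq> D\<close>]
    by (auto intro!: holomorphic_intros simp: S_def)
  have rep: "Phi x z = weier (a z) (g z) (h z)" if "z \<in> S" for z
    unfolding g_def h_def
    by (rule weier_of_null) (use that Phi_null[OF iso] in \<open>auto simp: S_def a_def\<close>)
  have sq: "(a z)\<^sup>2 * (deriv g z * deriv h z) = 1" if z: "z \<in> S" for z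
  proof -
    have zD: "z \<in> D" using z by (simp add: S_def)
    have "- 1 = Phi_deriv x z \<bullet>\<^sub>2 Phi_deriv x z"
      using can zD surface(4)[OF zD] Phi_deriv_normal_square[OF surface(1) zD iso _ hol]
      by (simp add: canonical_def)
    also have "\<dots> = - (a z)\<^sup>2 * (deriv g z * deriv h z)"
      unfolding Phi_deriv_def by (rule weier_deriv_square[OF \<open>open S\<close> z holS rep])
    finally show ?thesis by simp
  qed
  \<comment> \<open>By \<open>Phi_norm\<close> and \<open>weier_norm\<close> this product is x_u^2 +
    x_v^2 up to a positive factor.\<close>
  have pos: "(1 - (cmod (g z))\<^sup>2) * (1 - (cmod (h z))\<^sup>2) > 0" if z: "z \<in> S" for z
  proof -
    have "z \<in> D" using z by (simp add: S_def)
    then have "du x z \<bullet>\<^sub>2 du x z + dv x z \<bullet>\<^sub>2 dv x z > 0"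
      using surface(4)[of z] iso by (simp add: isothermal_def)
    then have "0 < (cmod (a z))\<^sup>2 / 2 * ((1 - (cmod (g z))\<^sup>2) * (1 - (cmod (h z))\<^sup>2))"
      using Phi_norm[of x z] by (simp only: rep[OF z] weier_norm)
    moreover have "0 < (cmod (a z))\<^sup>2 / 2" using z by (simp add: S_def)
    ultimately show ?thesis by (rule zero_less_mult_pos)
  qed
  have both: "cmod (g z) > 1 \<and> cmod (h z) > 1 \<or> cmod (g z) < 1 \<and> cmod (h z) < 1" if "z \<in> S" for z
    using pos[OF that] by (simp add: one_minus_square_mult_pos_iff)
  \<comment> \<open>\<open>\<bar>g\<bar>\<close> is kept on the side of 1 where it is at \<open>p\<close>; \<open>both\<close> then forces \<open>\<bar>h\<bar>\<close> to the same side.\<close>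
  define T where "T = (if cmod (g p) > 1 then {r::real. r > 1} else {r. r < 1})"
  have "open T" unfolding T_def by (simp add: open_Collect_less)
  define U where "U = S \<inter> (\<lambda>z. cmod (g z)) -` T"
  have "open U"
    unfolding U_def using \<open>open S\<close> \<open>open T\<close> holS(2)
    by (intro continuous_open_preimage continuous_on_norm holomorphic_on_imp_continuous_on)
  moreover have "p \<in> U" using \<open>p \<in> S\<close> both[of p] by (auto simp: U_def T_def)
  moreover have "U \<subseteq> S" by (auto simp: U_def)
  moreover have "admissible_pair U g h"
  proof -
    have "deriv g z * deriv h z \<noteq> 0" if "z \<in> U" for z
      using sq[of z] that \<open>U \<subseteq> S\<close> by force
    moreover have "(\<forall>z\<in>U. cmod (g z) > 1 \<and> cmod (h z) > 1) \<or> (\<forall>z\<in>U. cmod (g z) < 1 \<and> cmod (h z) < 1)"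
      using both by (fastforce simp: U_def T_def split: if_splits)
    ultimately show ?thesis
      using holS holomorphic_on_subset[OF _ \<open>U \<subseteq> S\<close>] unfolding admissible_pair_def by blast
  qed
  \<comment> \<open>The branch of the square root is \<open>1 / a\<close>; \<open>sq\<close> says
    that its square is g' h'.\<close>
  moreover have "weierstrass_rep U (Phi x) g h"
    unfolding weierstrass_rep_iff
  proof (intro exI[of _ "\<lambda>z. 1 / a z"] conjI ballI)
    show "(\<lambda>z. 1 / a z) holomorphic_on U"
      using holomorphic_on_subset[OF holS(1) \<open>U \<subseteq> S\<close>]
      by (auto intro!: holomorphic_intros simp: U_def S_def)
    fix z assume "z \<in> U"
    then have "z \<in> S" using \<open>U \<subseteq> S\<close> by blast
    then show "(1 / a z)\<^sup>2 = deriv g z * deriv h z" "Phi x z = weier (1 / (1 / a z)) (g z) (h z)"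
      using sq[of z] rep[of z] by (auto simp: S_def field_simps)
  qed
  ultimately show ?thesis using \<open>S \<subseteq> D\<close> by blast
qed

text \<open>The root \<open>s\<close> cannot vanish because its square is g1' g2', so the null
  coordinates of \<Phi> are a, a g1, a g2 with a = 1/s; the quotients do not depend on the
  branch.\<close>

lemma weierstrass_rep_unique:
  assumes "admissible_pair V g1 g2" "weierstrass_rep V \<Phi> g1 g2" "t \<in> V"
  shows "\<Phi> t $ 1 + \<i> * \<Phi> t $ 2 \<noteq> 0"
    and "g1 t = (\<Phi> t $ 3 - \<i> * \<Phi> t $ 4) / (\<Phi> t $ 1 + \<i> * \<Phi> t $ 2)"
    and "g2 t = (\<Phi> t $ 3 + \<i> * \<Phi> t $ 4) / (\<Phi> t $ 1 + \<i> * \<Phi> t $ 2)"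
proof -
  obtain s where s: "(s t)\<^sup>2 = deriv g1 t * deriv g2 t" "\<Phi> t = weier (1 / s t) (g1 t) (g2 t)"
    using assms(2,3) unfolding weierstrass_rep_iff by blast
  have "deriv g1 t * deriv g2 t \<noteq> 0"
    using assms(1,3) by (auto simp: admissible_pair_def)
  then have "s t \<noteq> 0" using s(1) by auto
  then show "\<Phi> t $ 1 + \<i> * \<Phi> t $ 2 \<noteq> 0"
    and "g1 t = (\<Phi> t $ 3 - \<i> * \<Phi> t $ 4) / (\<Phi> t $ 1 + \<i> * \<Phi> t $ 2)"
    and "g2 t = (\<Phi> t $ 3 + \<i> * \<Phi> t $ 4) / (\<Phi> t $ 1 + \<i> * \<Phi> t $ 2)"
    unfolding s(2) weier_coordinates by auto
qed

section \<open>Surfaces from holomorphic data\<close>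

lemma has_derivative_Re_vec:
  assumes "\<And>i. (F i has_field_derivative F' i) (at t)"
  shows "((\<lambda>z. \<chi> i. Re (F i z)) has_derivative (\<lambda>w. (\<chi> i. Re (F' i * w)) :: real^'n)) (at t)"
proof -
  have "((\<lambda>z. Re (F i z)) has_derivative (\<lambda>w. Re (F' i * w))) (at t)" for i
    using assms[of i] unfolding has_field_derivative_def
    by (rule bounded_linear.has_derivative[OF bounded_linear_Re])
  then show ?thesis
    by (subst has_derivative_componentwise_within) (auto simp: Basis_vec_def inner_axis)
qed

lemma du_dv_Re_vec:
  fixes f :: "complex \<Rightarrow> real^'n"
  assumes "open D" "t \<in> D" and F: "\<And>i. (F i has_field_derivative F' i) (at t)"
    and f: "\<And>z. z \<in> D \<Longrightarrow> f z = (\<chi> i. Re (F i z))"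
  shows "(f has_derivative (\<lambda>w. \<chi> i. Re (F' i * w))) (at t)"
    and "du f t = (\<chi> i. Re (F' i))" "dv f t = (\<chi> i. Re (\<i> * F' i))"
proof -
  show *: "(f has_derivative (\<lambda>w. \<chi> i. Re (F' i * w))) (at t)"
    by (rule has_derivative_transform_within_open[OF has_derivative_Re_vec[OF F] assms(1,2)]) (simp add: f)
  show "du f t = (\<chi> i. Re (F' i))" "dv f t = (\<chi> i. Re (\<i> * F' i))"
    by (simp_all add: du_dvI[OF *] mult.commute)
qed

text \<open>The class of real parts of holomorphic vectors is closed under both partial derivatives,
  which replace F by F' and by iF'. Hence the induction is over all \<open>F\<close> and
  \<open>f\<close>, with equality required only on \<open>D\<close>.\<close>

lemma C_diff_Re_vec:
  fixes f :: "complex \<Rightarrow> real^'n"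
  assumes "open D" and "\<And>i. F i holomorphic_on D" and "\<And>z. z \<in> D \<Longrightarrow> f z = (\<chi> i. Re (F i z))"
  shows "C_diff k D f"
  using assms(2,3)
proof (induction k arbitrary: F f)
  case 0
  have "continuous_on D (\<lambda>z. \<chi> i. Re (F i z))"
    by (intro continuous_on_vec_lambda continuous_on_Re holomorphic_on_imp_continuous_on 0)
  then show ?case
    using 0(2) by (simp cong: continuous_on_cong)
next
  case (Suc k)
  have d: "(F i has_field_derivative deriv (F i) t) (at t)" if "t \<in> D" for i t
    using holomorphic_derivI[OF Suc.prems(1) assms(1) that] .
  note partials = du_dv_Re_vec[OF assms(1) _ d Suc.prems(2)]
  have hol: "deriv (F i) holomorphic_on D" "(\<lambda>z. \<i> * deriv (F i) z) holomorphic_on D" for i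
    using holomorphic_deriv[OF Suc.prems(1) assms(1)] by (auto intro: holomorphic_intros)
  have "f differentiable (at t)" if "t \<in> D" for t
    using partials(1)[OF that that] that by (auto simp: differentiable_def)
  then show ?case
    using Suc.IH[of "\<lambda>i. deriv (F i)" "du f", OF hol(1)] Suc.IH[of "\<lambda>i z. \<i> * deriv (F i) z" "dv f", OF hol(2)]
      partials(2,3) by simp
qed

text \<open>A disc around \<open>p\<close> is convex, so both the square root of g1' g2' and a
  primitive of \<Phi> exist on it.\<close>

lemma surface_of_weierstrass_data:
  assumes dom: "is_domain D" and adm: "admissible_pair D g1 g2" and p: "p \<in> D"
  shows "\<exists>D0 x. is_domain D0 \<and> p \<in> D0 \<and> D0 \<subseteq> D \<and>
     maximal_spacelike_surface D0 x \<and> isothermal D0 x \<and> general_type D0 x \<and>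
     weierstrass_rep D0 (Phi x) g1 g2 \<and> (\<forall>t\<in>D0. Phi x t $ 1 + \<i> * Phi x t $ 2 \<noteq> 0)"
proof -
  obtain e where e: "e > 0" "ball p e \<subseteq> D"
    using dom p by (meson is_domain_def open_contains_ball)
  define B where "B = ball p e"
  have B: "open B" "convex B" "p \<in> B" "B \<subseteq> D" "is_domain B"
    using e by (auto simp: B_def is_domain_def)
  have g: "g1 holomorphic_on B" "g2 holomorphic_on B"
    using adm holomorphic_on_subset[OF _ \<open>B \<subseteq> D\<close>] by (auto simp: admissible_pair_def)
  have ne: "deriv g1 z * deriv g2 z \<noteq> 0" if "z \<in> B" for z
    using adm B that by (auto simp: admissible_pair_def)
  have dg: "(\<lambda>z. deriv g1 z * deriv g2 z) holomorphic_on B"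
    by (intro holomorphic_intros g B)
  obtain l where l: "l holomorphic_on B" "\<And>z. z \<in> B \<Longrightarrow> exp (l z) = deriv g1 z * deriv g2 z"
    by (rule holomorphic_logarithm_exists[OF B(2,1) dg ne B(3)]) blast+
  \<comment> \<open>Halving a logarithm of g1' g2' gives a holomorphic root without zeros.\<close>
  define s where "s z = exp (l z / 2)" for z
  have s_hol: "s holomorphic_on B"
    unfolding s_def[abs_def] by (intro holomorphic_intros l) auto
  have s: "\<And>z. z \<in> B \<Longrightarrow> (s z)\<^sup>2 = deriv g1 z * deriv g2 z" "\<And>z. s z \<noteq> 0"
    using l by (simp_all add: s_def power2_eq_square flip: exp_add)
  define \<Phi> where "\<Phi> z = weier (1 / s z) (g1 z) (g2 z)" for z
  have "\<forall>i. (\<lambda>z. \<Phi> z $ i) holomorphic_on B"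
    unfolding \<Phi>_def forall_4 weier_nth using s s_hol by (intro conjI holomorphic_intros g) auto
  then have \<Phi>_hol: "(\<lambda>z. \<Phi> z $ i) holomorphic_on B" for i
    by blast
  then have "\<exists>F. \<forall>z\<in>B. (F has_field_derivative \<Phi> z $ i) (at z)" for i
    using holomorphic_convex_primitive'[OF B(2,1) \<Phi>_hol[of i]] at_within_open[OF _ B(1)] by metis
  then obtain F where F: "\<And>i z. z \<in> B \<Longrightarrow> (F i has_field_derivative \<Phi> z $ i) (at z)"
    by metis
  \<comment> \<open>Then x_u = Re \<Phi> and x_v = Re (i \<Phi>) = -Im \<Phi>, so x_u - i x_v is
    exactly \<Phi>, with no scaling factor.\<close>
  define x :: "complex \<Rightarrow> real^4" where "x z = (\<chi> i. Re (F i z))" for z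
  have x: "(x has_derivative (\<lambda>w. \<chi> i. Re (\<Phi> z $ i * w))) (at z)"
    "du x z = (\<chi> i. Re (\<Phi> z $ i))" "dv x z = (\<chi> i. Re (\<i> * \<Phi> z $ i))" if "z \<in> B" for z
    using du_dv_Re_vec[OF B(1) that F[OF that], of x] by (simp_all add: x_def)
  have Phi: "Phi x z = \<Phi> z" if "z \<in> B" for z
    by (simp add: Phi_def cplx_def x[OF that] vec_eq_iff complex_eq_iff)
  have null: "\<Phi> z \<bullet>\<^sub>2 \<Phi> z = 0" for z
    unfolding \<Phi>_def by (rule weier_null)
  have iso: "isothermal B x"
    unfolding isothermal_def
  proof (intro ballI)
    fix z assume "z \<in> B"
    then have "Phi x z \<bullet>\<^sub>2 Phi x z = 0" by (simp add: Phi null)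
    \<comment> \<open>The real and imaginary parts of \<Phi>^2 = 0 are the two isothermal
      conditions.\<close>
    then have "complex_of_real (du x z \<bullet>\<^sub>2 du x z - dv x z \<bullet>\<^sub>2 dv x z) - 2 * \<i> * of_real (du x z \<bullet>\<^sub>2 dv x z) = 0"
      by (simp add: Phi_def sprod_simps sprod_cplx sprod_commute[of "dv x z" "du x z"] algebra_simps)
    then show "du x z \<bullet>\<^sub>2 du x z = dv x z \<bullet>\<^sub>2 dv x z \<and> du x z \<bullet>\<^sub>2 dv x z = 0"
      by (simp add: complex_eq_iff)
  qed
  have E: "du x z \<bullet>\<^sub>2 du x z > 0" if z: "z \<in> B" for z
  proof -
    have "z \<in> D" using z B by blast
    then have "cmod (g1 z) > 1 \<and> cmod (g2 z) > 1 \<or> cmod (g1 z) < 1 \<and> cmod (g2 z) < 1"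
      using adm by (auto simp: admissible_pair_def)
    then have pos: "(1 - (cmod (g1 z))\<^sup>2) * (1 - (cmod (g2 z))\<^sup>2) > 0"
      by (simp add: one_minus_square_mult_pos_iff)
    have "du x z \<bullet>\<^sub>2 du x z + dv x z \<bullet>\<^sub>2 dv x z > 0"
      using s(2)[of z] unfolding Phi_norm[symmetric] Phi[OF z] \<Phi>_def weier_norm
      by (intro mult_pos_pos[OF _ pos]) simp
    then show ?thesis using iso z by (simp add: isothermal_def)
  qed
  have diff: "x differentiable (at z)" if "z \<in> B" for z
    using x(1)[OF that] by (auto simp: differentiable_def)
  have space: "spacelike B x"
    unfolding spacelike_def
  proof (intro ballI allI impI)
    fix z w :: complex assume z: "z \<in> B" and w: "w \<noteq> 0"
    \<comment> \<open>The induced metric is conformal to the Euclidean one, so positivity in one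
      direction suffices.\<close>
    have "frechet_derivative x (at z) w \<bullet>\<^sub>2 frechet_derivative x (at z) w = (cmod w)\<^sup>2 * (du x z \<bullet>\<^sub>2 du x z)"
    proof -
      have "dv x z \<bullet>\<^sub>2 dv x z = du x z \<bullet>\<^sub>2 du x z" "du x z \<bullet>\<^sub>2 dv x z = 0" "dv x z \<bullet>\<^sub>2 du x z = 0"
        using iso z by (simp_all add: isothermal_def sprod_commute[of "dv x z" "du x z"])
      then show ?thesis
        unfolding frechet_derivative_du_dv[OF diff[OF z]] cmod_power2
        by (simp add: sprod_simps sprod_scaleR power2_eq_square algebra_simps)
    qed
    then show "0 < frechet_derivative x (at z) w \<bullet>\<^sub>2 frechet_derivative x (at z) w"
      using E[OF z] w by simp
  qed
  have inj: "inj (frechet_derivative x (at z))" if z: "z \<in> B" for z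
  proof -
    \<comment> \<open>A nonzero kernel vector would have an image of square 0, against
      positivity.\<close>
    have "w = 0" if "frechet_derivative x (at z) w = 0" for w
      using space z that by (force simp: spacelike_def sprod_def)
    then show ?thesis
      using linear_frechet_derivative[OF diff[OF z]] by (simp add: linear_injective_0)
  qed
  have smooth: "smooth B x"
    unfolding smooth_def
  proof
    show "C_diff k B x" for k
      by (rule C_diff_Re_vec[OF B(1), of F]) (use F B(1) in \<open>auto simp: x_def holomorphic_on_open\<close>)
  qed
  have "mean_curv x z = 0" if z: "z \<in> B" for z
  proof -
    have d: "((\<lambda>z. \<Phi> z $ i) has_field_derivative deriv (\<lambda>z. \<Phi> z $ i) z) (at z)" for i
      using holomorphic_derivI[OF \<Phi>_hol B(1) z] .
    have "du (du x) z = (\<chi> i. Re (deriv (\<lambda>z. \<Phi> z $ i) z))"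
      by (rule du_dv_Re_vec(2)[OF B(1) z d x(2)])
    moreover have "dv (dv x) z = (\<chi> i. Re (\<i> * (\<i> * deriv (\<lambda>z. \<Phi> z $ i) z)))"
      by (rule du_dv_Re_vec(3)[OF B(1) z DERIV_cmult[OF d] x(3)])
    \<comment> \<open>The pure second derivatives are Re \<Phi>' and Re (i i \<Phi>'), which
      cancel.\<close>
    ultimately have L: "du (du x) z + dv (dv x) z = 0"
      by (simp add: vec_eq_iff)
    have "dv x z \<bullet>\<^sub>2 dv x z = du x z \<bullet>\<^sub>2 du x z" "du x z \<bullet>\<^sub>2 dv x z = 0" "du x z \<bullet>\<^sub>2 du x z \<noteq> 0"
      using iso z E[OF z] by (auto simp: isothermal_def)
    note iso_z = refl this
    show ?thesis
      unfolding mean_curv_isothermal[OF iso_z] normal_part_isothermal[OF iso_z] L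
      by (simp add: sprod_def vec_eq_iff)
  qed
  then have "maximal_spacelike_surface B x"
    using B(5) smooth inj space by (simp add: maximal_spacelike_surface_def immersed_surface_def)
  moreover have "general_type B x"
    unfolding general_type_def degenerate_point_def
  proof
    fix z assume z: "z \<in> B"
    have hol: "(\<lambda>z. Phi x z $ i) holomorphic_on B" for i
      using \<Phi>_hol[of i] by (rule holomorphic_transform) (simp add: Phi)
    have "Phi_deriv_normal x z \<bullet>\<^sub>2 Phi_deriv_normal x z = Phi_deriv x z \<bullet>\<^sub>2 Phi_deriv x z"
      using E[OF z] by (intro Phi_deriv_normal_square[OF B(1) z iso _ hol]) simp
    also have "\<dots> = - (1 / s z)\<^sup>2 * (deriv g1 z * deriv g2 z)"
      unfolding Phi_deriv_def
      by (rule weier_deriv_square[OF B(1) z _ g]) (use s s_hol in \<open>auto simp: Phi \<Phi>_def intro!: holomorphic_intros\<close>)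
    \<comment> \<open>Since s^2 = g1' g2', the value is in fact -1.\<close>
    finally show "Phi_deriv_normal x z \<bullet>\<^sub>2 Phi_deriv_normal x z \<noteq> 0"
      using s(2)[of z] ne[OF z] by simp
  qed
  moreover have "weierstrass_rep B (Phi x) g1 g2"
    unfolding weierstrass_rep_iff using s s_hol by (intro exI[of _ s]) (auto simp: Phi \<Phi>_def)
  moreover have "Phi x z $ 1 + \<i> * Phi x z $ 2 \<noteq> 0" if "z \<in> B" for z
    using s(2)[of z] by (simp only: Phi[OF that] \<Phi>_def weier_coordinates) simp
  ultimately show ?thesis
    using B iso by (intro exI[of _ B] exI[of _ x] conjI ballI) assumption+
qed

theorem theorem10p3:
  shows "(\<forall>(D :: complex set) (x :: complex \<Rightarrow> real^4) p.
            maximal_spacelike_surface D x \<and> canonical D x \<and> p \<in> D \<and>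
            Phi x p $ 1 + \<i> * Phi x p $ 2 \<noteq> 0 \<longrightarrow>
              (\<exists>U g1 g2. open U \<and> p \<in> U \<and> U \<subseteq> D \<and>
                 admissible_pair U g1 g2 \<and> weierstrass_rep U (Phi x) g1 g2) \<and>
              (\<forall>V g1 g2. open V \<and> p \<in> V \<and> V \<subseteq> D \<and>
                 admissible_pair V g1 g2 \<and> weierstrass_rep V (Phi x) g1 g2 \<longrightarrow>
                 (\<forall>t\<in>V. Phi x t $ 1 + \<i> * Phi x t $ 2 \<noteq> 0 \<and>
                    g1 t = (Phi x t $ 3 - \<i> * Phi x t $ 4) / (Phi x t $ 1 + \<i> * Phi x t $ 2) \<and>
                    g2 t = (Phi x t $ 3 + \<i> * Phi x t $ 4) / (Phi x t $ 1 + \<i> * Phi x t $ 2))))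
       \<and> (\<forall>(D :: complex set) g1 g2 p.
            is_domain D \<and> admissible_pair D g1 g2 \<and> p \<in> D \<longrightarrow>
              (\<exists>D0 (x :: complex \<Rightarrow> real^4). is_domain D0 \<and> p \<in> D0 \<and> D0 \<subseteq> D \<and>
                 maximal_spacelike_surface D0 x \<and> isothermal D0 x \<and> general_type D0 x \<and>
                 weierstrass_rep D0 (Phi x) g1 g2 \<and>
                 (\<forall>t\<in>D0. Phi x t $ 1 + \<i> * Phi x t $ 2 \<noteq> 0)))"
proof (intro conjI allI impI)
  fix D x p
  assume "maximal_spacelike_surface D x \<and> canonical D x \<and> p \<in> D \<and>
    Phi x p $ 1 + \<i> * Phi x p $ 2 \<noteq> 0"
  then show "\<exists>U g1 g2. open U \<and> p \<in> U \<and> U \<subseteq> D \<and>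
      admissible_pair U g1 g2 \<and> weierstrass_rep U (Phi x) g1 g2"
    using weierstrass_rep_local_existence by blast
next
  fix D g1 g2 p
  assume "is_domain D \<and> admissible_pair D g1 g2 \<and> p \<in> D"
  then show "\<exists>D0 x. is_domain D0 \<and> p \<in> D0 \<and> D0 \<subseteq> D \<and>
      maximal_spacelike_surface D0 x \<and> isothermal D0 x \<and> general_type D0 x \<and>
      weierstrass_rep D0 (Phi x) g1 g2 \<and> (\<forall>t\<in>D0. Phi x t $ 1 + \<i> * Phi x t $ 2 \<noteq> 0)"
    using surface_of_weierstrass_data by blast
qed (use weierstrass_rep_unique in blast)+

end
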